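(* The Reissner-Nordström-de Sitter (RNdS) spacetime with parameters $M,e,\Lambda$ (metric and all notation as in the context) satisfies the following curvature conditions: (i) $R\cdot C=-\frac{e^2-Mr+\Lambda r^4}{r^4}Q(g,C)$, i.e. the spacetime is conformally pseudosymmetric. (ii) $C\cdot Ric=\frac{Mr-e^2}{r^4}Q(g,Ric)$, i.e. it is Ricci pseudosymmetric due to the conformal tensor. (iii) $C\cdot C=\frac{Mr-e^2}{r^4}Q(g,C)$ and $C\cdot R=\frac{Mr-e^2}{r^4}Q(g,R)$, i.e. the spacetime is pseudosymmetric due to the conformal tensor and is also a Ricci generalized conformal pseudosymmetric manifold. (iv) $R\cdot R-Q(Ric,R)=\frac{2e^4-6e^2Mr+3M^2r^2-6\Lambda e^2r^4+6M\Lambda r^5}{3r^4(Mr-e^2)}\,Q(g,C)$. (v) $C\cdot R-R\cdot C=\mathcal L_1Q(g,R)+\mathcal L_2Q(Ric,R)$, where, with $Y_2=-Mr+\Lambda r^4+e^2$ and $Y_6=Mr-e^2$, $$\mathcal L_1=\frac{Y_6}{r^4}\Big\{1-\frac{3Y_2^2}{3Mr(Mr-2e^2)-6\Lambda r^4Y_6+2e^4}\Big\},\qquad \mathcal L_2=\frac{3Y_6Y_2}{3Mr(Mr-2e^2)-6\Lambda r^4Y_6+2e^4}.$$ (vi) $C\cdot R-R\cdot C=4\Lambda\,Q(g,C)+Q(Ric,C)$.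
   Context: Metric: $M$ (mass), $e\neq0$ (electric charge) and $\Lambda>0$ (cosmological constant) are constants, $f(r)=1-\frac{2M}{r}+\frac{e^2}{r^2}-\Lambda r^2$, and in coordinates $(x^1,x^2,x^3,x^4)=(t,r,\theta,\phi)$ the RNdS metric is $g=-f\,dt^2+f^{-1}dr^2+r^2(d\theta^2+\sin^2\theta\,d\phi^2)$; $n=4$. Curvature: with Christoffel symbols $\Gamma^k_{ij}$ of $g$, the Riemann tensor is $R_{hijk}=g_{h\alpha}(\partial_k\Gamma^\alpha_{ij}-\partial_j\Gamma^\alpha_{ik}+\Gamma^\beta_{ij}\Gamma^\alpha_{\beta k}-\Gamma^\beta_{ik}\Gamma^\alpha_{\beta j})$; $Ric$ is the Ricci tensor (the trace of $R$) and $\kappa$ the scalar curvature (the trace of $Ric$), with computed value $\kappa=-12\Lambda$. For symmetric $(0,2)$ tensors $F,H$ the Kulkarni-Nomizu product is $(F\wedge H)_{ijkl}=F_{il}H_{jk}-F_{ik}H_{jl}+F_{jk}H_{il}-F_{jl}H_{ik}$. The conformal curvature tensor is $C=R-\frac1{n-2}g\wedge Ric+\frac{\kappa}{2(n-1)(n-2)}g\wedge g$. Operations: for a $(0,4)$ tensor $X$ with associated $(1,3)$ tensor $X^\alpha{}_{wsb}=g^{\alpha\beta}X_{wsb\beta}$, a $(0,d)$ tensor $Y$ and a symmetric $(0,2)$ tensor $A$: $(X\cdot Y)_{b_1\cdots b_dws}=-\sum_{p=1}^dX^\alpha{}_{wsb_p}Y_{b_1\cdots\alpha\cdots b_d}$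 and $Q(A,Y)_{b_1\cdots b_dij}=\sum_{p=1}^d\big(A_{jb_p}Y_{b_1\cdots i\cdots b_d}-A_{ib_p}Y_{b_1\cdots j\cdots b_d}\big)$, where $\alpha$, $i$, $j$ stand in the $p$-th slot of $Y$. Terminology: a manifold is $Y$-pseudosymmetric with respect to (due to) $X$ if $X\cdot Y=f_YQ(g,Y)$ for a smooth function $f_Y$, and Ricci generalized $Y$-pseudosymmetric with respect to $X$ if $X\cdot Y=\bar f_YQ(Ric,Y)$ for a smooth function $\bar f_Y$.
   Formalization: In (v) the signs of 6Λr⁴Y₆ (both denominators) and of L₂ are corrected; C is the trace-free tensor (printed formula with −Ric, −κ, since κ=−12Λ); the false "Ricci generalized conformal pseudosymmetric" claim in (iii) is dropped; (iv), (v) hold where denominators are nonzero. *)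

theory Defs
  imports "HOL-Analysis.Analysis"
begin

text \<open>
  A covariant tensor field of order \<open>d\<close> on a coordinate patch is given by its components:
  \<open>Y x [i\<^sub>1, \<dots>, i\<^sub>d]\<close> is the component at the point with coordinates \<open>x\<close>. Only index lists
  of length \<open>d\<close> are meaningful. A metric is a field of symmetric invertible matrices.
\<close>

type_synonym 'n metric = "real ^ 'n \<Rightarrow> real ^ 'n ^ 'n"
type_synonym 'n tensor_field = "real ^ 'n \<Rightarrow> 'n list \<Rightarrow> real"

definition partial :: "'n::finite \<Rightarrow> (real ^ 'n \<Rightarrow> real) \<Rightarrow> real ^ 'n \<Rightarrow> real" where
  "partial i h x = deriv (\<lambda>s. h (x + s *\<^sub>R axis i 1)) 0"

primrec Ck_on :: "nat \<Rightarrow> (real ^ 'n::finite) set \<Rightarrow> (real ^ 'n \<Rightarrow> real) \<Rightarrow> bool" where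
  "Ck_on 0 S h = continuous_on S h"
| "Ck_on (Suc k) S h =
     (continuous_on S h \<and>
      (\<forall>i. (\<forall>x\<in>S. (\<lambda>s. h (x + s *\<^sub>R axis i 1)) differentiable (at 0)) \<and> Ck_on k S (partial i h)))"

definition smooth_on :: "(real ^ 'n::finite) set \<Rightarrow> (real ^ 'n \<Rightarrow> real) \<Rightarrow> bool" where
  "smooth_on S h \<longleftrightarrow> open S \<and> (\<forall>k. Ck_on k S h)"

definition metric_tensor :: "'n metric \<Rightarrow> 'n::finite tensor_field" where
  "metric_tensor g x b = (case b of [i, j] \<Rightarrow> g x $ i $ j | _ \<Rightarrow> 0)"

definition ginv :: "'n metric \<Rightarrow> real ^ 'n \<Rightarrow> 'n::finite \<Rightarrow> 'n \<Rightarrow> real" where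
  "ginv g x i j = matrix_inv (g x) $ i $ j"

text \<open>\<open>christoffel g k i j\<close> is \<open>\<Gamma>\<^sup>k\<^sub>i\<^sub>j\<close>.\<close>

definition christoffel :: "'n metric \<Rightarrow> 'n::finite \<Rightarrow> 'n \<Rightarrow> 'n \<Rightarrow> real ^ 'n \<Rightarrow> real" where
  "christoffel g k i j x =
     (1/2) * (\<Sum>l\<in>UNIV. ginv g x k l *
        (partial i (\<lambda>y. g y $ j $ l) x + partial j (\<lambda>y. g y $ i $ l) x - partial l (\<lambda>y. g y $ i $ j) x))"

definition riemann :: "'n metric \<Rightarrow> 'n::finite tensor_field" where
  "riemann g x b = (case b of [h, i, j, k] \<Rightarrow>
     (\<Sum>\<alpha>\<in>UNIV. g x $ h $ \<alpha> *
        (partial k (christoffel g \<alpha> i j) x - partial j (christoffel g \<alpha> i k) x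
         + (\<Sum>\<beta>\<in>UNIV. christoffel g \<beta> i j x * christoffel g \<alpha> \<beta> k x)
         - (\<Sum>\<beta>\<in>UNIV. christoffel g \<beta> i k x * christoffel g \<alpha> \<beta> j x))) | _ \<Rightarrow> 0)"

text \<open>
  The Ricci tensor is the contraction over the first and third slots. With the sign of
  \<open>riemann\<close> above, this is the choice of trace for which the Reissner-Nordstroem-de Sitter
  metric has scalar curvature \<open>-12\<Lambda>\<close> (contracting over the first and fourth slots gives
  \<open>12\<Lambda>\<close>).
\<close>

definition ricci :: "'n metric \<Rightarrow> 'n::finite tensor_field" where
  "ricci g x b = (case b of [i, j] \<Rightarrow>
     (\<Sum>h\<in>UNIV. \<Sum>k\<in>UNIV. ginv g x h k * riemann g x [h, i, k, j]) | _ \<Rightarrow> 0)"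

definition scalar_curvature :: "'n metric \<Rightarrow> real ^ 'n::finite \<Rightarrow> real" where
  "scalar_curvature g x = (\<Sum>i\<in>UNIV. \<Sum>j\<in>UNIV. ginv g x i j * ricci g x [i, j])"

definition kulkarni_nomizu :: "'n tensor_field \<Rightarrow> 'n tensor_field \<Rightarrow> 'n::finite tensor_field" where
  "kulkarni_nomizu F H x b = (case b of [i, j, k, l] \<Rightarrow>
     F x [i, l] * H x [j, k] - F x [i, k] * H x [j, l]
     + F x [j, k] * H x [i, l] - F x [j, l] * H x [i, k] | _ \<Rightarrow> 0)"

text \<open>
  The conformal curvature tensor, i.e. the trace-free part
  \<open>C = R - 1/(n-2) (g \<and> S) + s/(2(n-1)(n-2)) (g \<and> g)\<close> of the curvature tensor. With the
  sign of the product \<open>\<and>\<close> used here, this is trace-free exactly when \<open>S\<close> is the contraction of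
  \<open>R\<close> over the first and fourth slots and \<open>s\<close> its trace. By antisymmetry of \<open>R\<close> in its last
  two slots, these are \<open>-Ric\<close> and \<open>-\<kappa>\<close>.
\<close>

definition conformal :: "'n metric \<Rightarrow> 'n::finite tensor_field" where
  "conformal g x b =
     (let n = real CARD('n); S = (\<lambda>y c. - ricci g y c); s = - scalar_curvature g x in
        riemann g x b
        - 1 / (n - 2) * kulkarni_nomizu (metric_tensor g) S x b
        + s / (2 * (n - 1) * (n - 2)) * kulkarni_nomizu (metric_tensor g) (metric_tensor g) x b)"

text \<open>
  \<open>dot g X Y x b w s\<close> is the component \<open>(X \<cdot> Y)\<^bsub>b w s\<^esub>\<close>, and \<open>Q A Y x b i j\<close> is
  \<open>Q(A, Y)\<^bsub>b i j\<^esub>\<close>, where \<open>b\<close> lists the first \<open>d\<close> indices and \<open>Y\<close> has order \<open>d\<close>.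
\<close>

definition raise_last :: "'n metric \<Rightarrow> 'n tensor_field \<Rightarrow> real ^ 'n \<Rightarrow> 'n::finite \<Rightarrow> 'n \<Rightarrow> 'n \<Rightarrow> 'n \<Rightarrow> real" where
  "raise_last g X x \<alpha> w s b = (\<Sum>\<beta>\<in>UNIV. ginv g x \<alpha> \<beta> * X x [w, s, b, \<beta>])"

definition dot ::
  "'n metric \<Rightarrow> 'n tensor_field \<Rightarrow> 'n tensor_field \<Rightarrow> real ^ 'n \<Rightarrow> 'n list \<Rightarrow> 'n::finite \<Rightarrow> 'n \<Rightarrow> real" where
  "dot g X Y x b w s =
     - (\<Sum>p<length b. \<Sum>\<alpha>\<in>UNIV. raise_last g X x \<alpha> w s (b ! p) * Y x (b[p := \<alpha>]))"

definition Q ::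
  "'n tensor_field \<Rightarrow> 'n tensor_field \<Rightarrow> real ^ 'n \<Rightarrow> 'n list \<Rightarrow> 'n::finite \<Rightarrow> 'n \<Rightarrow> real" where
  "Q A Y x b i j =
     (\<Sum>p<length b. A x [j, b ! p] * Y x (b[p := i]) - A x [i, b ! p] * Y x (b[p := j]))"

text \<open>
  \<open>pseudosymmetric_wrt D g X d Y\<close>: on the patch \<open>D\<close>, the metric \<open>g\<close> is \<open>Y\<close>-pseudosymmetric
  with respect to \<open>X\<close>, where \<open>Y\<close> has order \<open>d\<close>.
\<close>

definition pseudosymmetric_wrt ::
  "(real ^ 'n) set \<Rightarrow> 'n metric \<Rightarrow> 'n tensor_field \<Rightarrow> nat \<Rightarrow> 'n::finite tensor_field \<Rightarrow> bool" where
  "pseudosymmetric_wrt D g X d Y \<longleftrightarrow>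
     (\<exists>f. smooth_on D f \<and>
        (\<forall>x\<in>D. \<forall>b w s. length b = d \<longrightarrow> dot g X Y x b w s = f x * Q (metric_tensor g) Y x b w s))"

text \<open>Coordinates: \<open>x $ 1 = t\<close>, \<open>x $ 2 = r\<close>, \<open>x $ 3 = \<theta>\<close>, \<open>x $ 4 = \<phi>\<close>.\<close>

definition rnds_f :: "real \<Rightarrow> real \<Rightarrow> real \<Rightarrow> real \<Rightarrow> real" where
  "rnds_f M e \<Lambda> r = 1 - 2 * M / r + e^2 / r^2 - \<Lambda> * r^2"

definition rnds_metric :: "real \<Rightarrow> real \<Rightarrow> real \<Rightarrow> 4 metric" where
  "rnds_metric M e \<Lambda> x = (\<chi> i j.
     if i \<noteq> j then 0
     else if i = 1 then - rnds_f M e \<Lambda> (x $ 2)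
     else if i = 2 then 1 / rnds_f M e \<Lambda> (x $ 2)
     else if i = 3 then (x $ 2)^2
     else (x $ 2)^2 * (sin (x $ 3))^2)"

text \<open>
  All points at which the coordinate expression of the metric is regular; both signs of \<open>f\<close>
  are allowed, so the regions on either side of a horizon are included.
\<close>

definition rnds_domain :: "real \<Rightarrow> real \<Rightarrow> real \<Rightarrow> (real ^ 4) set" where
  "rnds_domain M e \<Lambda> = {x. x $ 2 > 0 \<and> rnds_f M e \<Lambda> (x $ 2) \<noteq> 0 \<and> 0 < x $ 3 \<and> x $ 3 < pi}"

end

theory Submission
  imports Defs
begin

text \<open>
  In the coordinates used here the metric is diagonal, and so is the curvature operator on the
  coordinate planes: \<open>R\<close> is determined by one sectional curvature for each pair of indices
  (\<open>plane_form\<close>). For a tensor \<open>X\<close> of this shape with sectional values \<open>k\<close>, raising the last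
  index turns the endomorphism \<open>X(w, s)\<close> into \<open>k\<^sub>w\<^sub>s\<close> times the infinitesimal rotation
  \<open>\<partial>\<^sub>w \<and> \<partial>\<^sub>s\<close>, so that \<open>X \<cdot> Y = - k\<^sub>w\<^sub>s Q(g, Y)\<close> for every tensor \<open>Y\<close> (\<open>dot_plane_form\<close>).
  Every term of the claimed identities thereby becomes some \<open>Q(A, T)\<close> with \<open>A\<close> diagonal
  and \<open>T\<close> of the same shape. Such a \<open>Q(A, T)\<close> in the plane \<open>(i, j)\<close> depends only on the numbers
  \<open>a\<^sub>j k\<^sub>i\<^sub>v - a\<^sub>i k\<^sub>j\<^sub>v\<close> and is linear in them (\<open>Q_diag_plane\<close>).

  The metric is a warped product of the \<open>(t, r)\<close>-plane with the round sphere, so its sectional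
  curvatures take only three values: \<open>\<alpha>\<close> on the base, \<open>\<beta>\<close> on mixed planes and \<open>\<delta>\<close> on the fibre.
  Rotations inside the base or inside the fibre preserve \<open>R\<close>, \<open>Ric\<close> and \<open>C\<close>; hence, for
  these \<open>Y\<close>, the tensor \<open>X \<cdot> Y\<close> sees only the mixed value of \<open>X\<close>, which is pseudosymmetry with the factor \<open>-\<beta>\<close> for \<open>X = R\<close> and \<open>\<mu>\<close> for
  \<open>X = C\<close>. Here \<open>\<mu> = (\<alpha> + \<delta> - 2 \<beta>) / 6\<close> and \<open>C\<close> has the values \<open>2 \<mu>\<close>, \<open>- \<mu>\<close>, \<open>2 \<mu>\<close>. The remaining
  identities involve \<open>Q(Ric, R)\<close> and \<open>Q(Ric, C)\<close>. Each amounts to two scalar equations in \<open>\<alpha>\<close>,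
  \<open>\<beta>\<close>, \<open>\<delta>\<close>, one for \<open>v\<close> in the base and one for \<open>v\<close> in the fibre, and holds for any curvature of
  this block form:
  \<open>R \<cdot> R - Q(Ric, R) = (\<alpha> \<delta> - \<beta>\<^sup>2) / (3 \<mu>) Q(g, C)\<close>, and
  \<open>C \<cdot> R - R \<cdot> C\<close> equals both \<open>- \<kappa> / 3 Q(g, C) + Q(Ric, C)\<close>, with \<open>\<kappa> = - 2 (\<alpha> + \<delta> + 4 \<beta>)\<close> the scalar
  curvature, and a combination of \<open>Q(g, R)\<close> and \<open>Q(Ric, R)\<close> when \<open>\<alpha> \<delta> \<noteq> \<beta>\<^sup>2\<close>.

  What remains is to compute \<open>\<alpha>\<close>, \<open>\<beta>\<close>, \<open>\<delta>\<close>. For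
  \<open>- F dt\<^sup>2 + dr\<^sup>2 / F + r\<^sup>2 d\<Omega>\<^sup>2\<close> with an arbitrary twice differentiable \<open>F\<close> they are \<open>- F'' / 2\<close>,
  \<open>- F' / (2 r)\<close> and \<open>(1 - F) / r\<^sup>2\<close> (\<open>riemann_sss_metric\<close>).
\<close>

section \<open>Tensors that are diagonal on coordinate planes\<close>

definition diag_at :: "('n::finite \<Rightarrow> real) \<Rightarrow> real ^ 'n ^ 'n \<Rightarrow> bool" where
  "diag_at \<gamma> G \<longleftrightarrow> (\<forall>i. \<gamma> i \<noteq> 0) \<and> G = (\<chi> i j. if i = j then \<gamma> i else 0)"

lemma matrix_inv_eqI:
  fixes A B :: "real ^ 'n::finite ^ 'n"
  assumes "A ** B = mat 1" "B ** A = mat 1"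
  shows "matrix_inv A = B"
proof -
  have *: "A ** matrix_inv A = mat 1"
    unfolding matrix_inv_def by (rule someI2[where a = B]) (use assms in auto)
  have "matrix_inv A = (B ** A) ** matrix_inv A" by (simp add: assms)
  also have "\<dots> = B ** (A ** matrix_inv A)" by (simp only: matrix_mul_assoc)
  finally show ?thesis by (simp add: *)
qed

lemma matrix_inv_diagonal:
  assumes "\<And>i. \<gamma> i \<noteq> 0"
  shows "matrix_inv (\<chi> i j. if i = j then \<gamma> i else (0::real)) =
    (\<chi> i j. if i = j then 1 / \<gamma> i else (0::real) :: real ^ 'n::finite ^ 'n)" (is "matrix_inv ?A = ?B")
proof (rule matrix_inv_eqI)
  have *: "(\<Sum>k\<in>UNIV. (if i = k then a i else 0) * (if k = j then b k else 0)) =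
      (if i = j then a i * b i else 0)" for a b :: "'n \<Rightarrow> real" and i j
  proof -
    have "(\<Sum>k\<in>UNIV. (if i = k then a i else 0) * (if k = j then b k else 0)) =
      (\<Sum>k\<in>UNIV. if k = i then (if i = j then a i * b i else 0) else 0)"
      by (intro sum.cong) auto
    then show ?thesis by simp
  qed
  have "(\<chi> i j. if i = j then a i else 0) ** (\<chi> i j. if i = j then b i else 0) =
      (\<chi> i j. if i = j then a i * b i else 0)" for a b :: "'n \<Rightarrow> real"
    unfolding matrix_matrix_mult_def vec_lambda_beta
    by (intro arg_cong[of _ _ vec_lambda] ext) (rule *)
  then show "?A ** ?B = mat 1" "?B ** ?A = mat 1"
    using assms by (simp_all add: mat_def cong: if_cong)
qed

text \<open>The mixed components \<open>A\<^sup>i\<^sub>i = a i\<close> are used, so that the metric itself has \<open>a = 1\<close>.\<close>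
definition diag_form :: "('n \<Rightarrow> real) \<Rightarrow> ('n \<Rightarrow> real) \<Rightarrow> real ^ 'n \<Rightarrow> 'n::finite tensor_field \<Rightarrow> bool" where
  "diag_form \<gamma> a x A \<longleftrightarrow> (\<forall>i j. A x [i, j] = (if i = j then a i * \<gamma> i else 0))"

text \<open>
  The number \<open>k h i\<close> is the sectional value of \<open>T\<close> on the coordinate plane \<open>(h, i)\<close>. The values
  \<open>k h h\<close> do not affect \<open>T\<close>; they may be chosen freely to make formulas uniform.
\<close>
definition plane_form :: "('n \<Rightarrow> real) \<Rightarrow> ('n \<Rightarrow> 'n \<Rightarrow> real) \<Rightarrow> real ^ 'n \<Rightarrow> 'n::finite tensor_field \<Rightarrow> bool" where
  "plane_form \<gamma> k x T \<longleftrightarrow>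
     (\<forall>h i. k h i = k i h) \<and>
     (\<forall>h i j l. T x [h, i, j, l] =
        k h i * \<gamma> h * \<gamma> i * (of_bool (h = l \<and> i = j) - of_bool (h = j \<and> i = l)))"

lemma plane_formD:
  "plane_form \<gamma> k x T \<Longrightarrow>
    T x [h, i, j, l] = k h i * \<gamma> h * \<gamma> i * (of_bool (h = l \<and> i = j) - of_bool (h = j \<and> i = l))"
  "plane_form \<gamma> k x T \<Longrightarrow> k h i = k i h"
  by (auto simp: plane_form_def)

lemma ginv_diag:
  "diag_at \<gamma> (g x) \<Longrightarrow> ginv g x i j = (if i = j then 1 / \<gamma> i else 0)"
  by (auto simp: diag_at_def ginv_def matrix_inv_diagonal)

lemma diag_form_metric:
  "diag_at \<gamma> (g x) \<Longrightarrow> diag_form \<gamma> (\<lambda>_. 1) x (metric_tensor g)"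
  by (auto simp: diag_form_def diag_at_def metric_tensor_def)

text \<open>
  The endomorphism obtained from \<open>X(w, s)\<close> is \<open>k w s\<close> times \<open>e\<^sub>w \<otimes> g(e\<^sub>s, _) - e\<^sub>s \<otimes> g(e\<^sub>w, _)\<close>.
  The derivation induced by the latter is, up to sign, what \<open>Q(g, Y)\<close> is made of; this is
  independent of the shape of \<open>Y\<close>.
\<close>
lemma dot_plane_form:
  assumes g: "diag_at \<gamma> (g x)" and X: "plane_form \<gamma> k x X"
  shows "dot g X Y x b w s = - k w s * Q (metric_tensor g) Y x b w s"
proof -
  have nz: "\<gamma> i \<noteq> 0" for i using g by (auto simp: diag_at_def)
  have G: "metric_tensor g x [i, j] = (if i = j then \<gamma> i else 0)" for i j
    using diag_form_metric[where g=g and \<gamma>=\<gamma>, OF g] by (simp add: diag_form_def)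
  have raise: "raise_last g X x \<alpha> w s c =
      k w s * ((if \<alpha> = w then metric_tensor g x [s, c] else 0)
             - (if \<alpha> = s then metric_tensor g x [w, c] else 0))" for \<alpha> c
  proof -
    have "raise_last g X x \<alpha> w s c = (\<Sum>\<beta>\<in>UNIV. (if \<alpha> = \<beta> then X x [w, s, c, \<beta>] / \<gamma> \<alpha> else 0))"
      unfolding raise_last_def by (intro sum.cong) (auto simp: ginv_diag[where g=g, OF g])
    also have "\<dots> = X x [w, s, c, \<alpha>] / \<gamma> \<alpha>" by simp
    finally show ?thesis
      using nz[of \<alpha>] by (cases "\<alpha> = w"; cases "\<alpha> = s") (auto simp: plane_formD(1)[OF X] G)
  qed
  have "(\<Sum>\<alpha>\<in>UNIV. raise_last g X x \<alpha> w s c * Y x (b[p := \<alpha>])) =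
     k w s * (metric_tensor g x [s, c] * Y x (b[p := w]) - metric_tensor g x [w, c] * Y x (b[p := s]))" for p c
  proof -
    have "(\<Sum>\<alpha>\<in>UNIV. raise_last g X x \<alpha> w s c * Y x (b[p := \<alpha>])) =
      (\<Sum>\<alpha>\<in>UNIV. (if \<alpha> = w then k w s * (metric_tensor g x [s, c] * Y x (b[p := w])) else 0)
        - (if \<alpha> = s then k w s * (metric_tensor g x [w, c] * Y x (b[p := s])) else 0))"
      by (intro sum.cong refl) (simp add: raise algebra_simps)
    then show ?thesis by (simp add: sum_subtractf right_diff_distrib)
  qed
  then show ?thesis
    by (simp only: dot_def Q_def sum_distrib_left mult_minus_left sum_negf)
qed

text \<open>Components of the bivector \<open>e\<^sub>u \<and> e\<^sub>v\<close>.\<close>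
definition bivec :: "'n \<Rightarrow> 'n \<Rightarrow> 'n \<Rightarrow> 'n \<Rightarrow> real" where
  "bivec u v h k = of_bool (h = u \<and> k = v) - of_bool (h = v \<and> k = u)"

text \<open>
  The common shape of all \<open>Q(A, T)\<close> in the plane \<open>(i, j)\<close>: the symmetric products of the bivectors
  \<open>e\<^sub>i \<and> e\<^sub>v\<close> and \<open>e\<^sub>j \<and> e\<^sub>v\<close>, weighted by \<open>z v\<close>. The terms \<open>v = i\<close> and \<open>v = j\<close> vanish, since one of
  the two bivectors is zero.
\<close>
definition mix_form :: "('n::finite \<Rightarrow> real) \<Rightarrow> ('n \<Rightarrow> real) \<Rightarrow> 'n list \<Rightarrow> 'n \<Rightarrow> 'n \<Rightarrow> real" where
  "mix_form \<gamma> z b i j = - \<gamma> i * \<gamma> j * (\<Sum>v\<in>UNIV. \<gamma> v * z v *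
     (bivec i v (b ! 0) (b ! 1) * bivec j v (b ! 2) (b ! 3) + bivec j v (b ! 0) (b ! 1) * bivec i v (b ! 2) (b ! 3)))"

lemma length4E: assumes "length b = 4" obtains h k l m where "b = [h, k, l, m]"
  using assms by (auto simp: numeral_eq_Suc length_Suc_conv)

lemma bivec_swap: "bivec u v h k = - bivec v u h k"
  by (simp add: bivec_def)

lemma plane_form_bivec:
  assumes "plane_form \<gamma> k x T"
  shows "T x [h, i, j, l] = - k h i * \<gamma> h * \<gamma> i * bivec h i j l"
proof -
  have "(j = h \<and> l = i) = (h = j \<and> i = l)" "(j = i \<and> l = h) = (h = l \<and> i = j)" by metis+
  then have "bivec h i j l = - (of_bool (h = l \<and> i = j) - of_bool (h = j \<and> i = l))"
    by (simp only: bivec_def minus_diff_eq)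
  then show ?thesis
    by (simp only: plane_formD(1)[OF assms] mult_minus_left mult_minus_right minus_minus)
qed

lemma plane_form_swap_pairs:
  assumes "plane_form \<gamma> k x T"
  shows "T x [h, i, j, l] = T x [j, l, h, i]"
proof -
  consider "j = h" "l = i" | "j = i" "l = h" | "\<not> (j = h \<and> l = i)" "\<not> (j = i \<and> l = h)" by blast
  then show ?thesis
  proof cases
    case 1
    then show ?thesis by simp
  next
    case 2
    have "bivec h i i h = bivec i h h i" by (cases "h = i") (simp_all add: bivec_def)
    then have "T x [h, i, i, h] = T x [i, h, h, i]"
      using plane_form_bivec[OF assms, of h i i h] plane_form_bivec[OF assms, of i h h i]
        plane_formD(2)[OF assms, of h i] by (metis mult.assoc mult.commute mult_minus_left)
    with 2 show ?thesis by metis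
  next
    case 3
    then have "bivec h i j l = 0" "bivec j l h i = 0" by (auto simp: bivec_def)
    then show ?thesis by (simp add: plane_form_bivec[OF assms])
  qed
qed

text \<open>
  Replacing \<open>u\<close> by \<open>w\<close> in the first pair of slots acts on \<open>e\<^sub>u \<and> e\<^sub>v\<close> and leaves the second pair
  alone; by \<open>plane_form_swap_pairs\<close> this also covers replacements in the second pair.
\<close>
lemma plane_form_replace:
  assumes T: "plane_form \<gamma> k x T"
  shows "of_bool (p = u) * T x [w, q, l, m] + of_bool (q = u) * T x [p, w, l, m] =
    - \<gamma> w * (\<Sum>v\<in>UNIV. \<gamma> v * k w v * (bivec u v p q * bivec w v l m))"
proof -
  have "(\<Sum>v\<in>UNIV. \<gamma> v * k w v * (bivec u v p q * bivec w v l m)) =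
      (\<Sum>v\<in>UNIV. (if v = q then \<gamma> q * k w q * of_bool (p = u) * bivec w q l m else 0)
         - (if v = p then \<gamma> p * k w p * of_bool (q = u) * bivec w p l m else 0))"
    by (intro sum.cong) (auto simp: bivec_def)
  also have "\<dots> = \<gamma> q * k w q * of_bool (p = u) * bivec w q l m - \<gamma> p * k w p * of_bool (q = u) * bivec w p l m"
    by (simp add: sum_subtractf)
  finally have sum: "(\<Sum>v\<in>UNIV. \<gamma> v * k w v * (bivec u v p q * bivec w v l m)) = \<dots>" .
  show ?thesis
    unfolding sum plane_form_bivec[OF T] plane_formD(2)[OF T, of p w] bivec_swap[of p w l m]
    by (simp add: algebra_simps)
qed

text \<open>
  The replacements of \<open>j\<close> by \<open>i\<close> contribute \<open>a j * k i v\<close>, those of \<open>i\<close> by \<open>j\<close> contribute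
  \<open>- a i * k j v\<close>, with the same bivector products. Together with \<open>mix_form_linear\<close> this reduces
  identities between the tensors \<open>Q(A, T)\<close> to scalar identities for each \<open>v\<close>.
\<close>
lemma Q_diag_plane:
  assumes A: "diag_form \<gamma> a x A" and T: "plane_form \<gamma> k x T" and b: "length b = 4"
  shows "Q A T x b i j = mix_form \<gamma> (\<lambda>v. a j * k i v - a i * k j v) b i j"
proof -
  obtain p q l m where b: "b = [p, q, l, m]" using length4E[OF b] .
  define U where "U u w p q l m =
    of_bool (p = u) * T x [w, q, l, m] + of_bool (q = u) * T x [p, w, l, m]" for u w p q l m
  have U: "U u w p q l m = - \<gamma> w * (\<Sum>v\<in>UNIV. \<gamma> v * k w v * (bivec u v p q * bivec w v l m))"
    for u w p q l m
    unfolding U_def by (rule plane_form_replace[OF T])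
  have A': "A x [i, c] = a i * \<gamma> i * of_bool (c = i)" for i c
    using A by (auto simp: diag_form_def)
  have swap: "T x [p, q, c, m] = T x [c, m, p, q]" "T x [p, q, l, c] = T x [l, c, p, q]" for c
    by (rule plane_form_swap_pairs[OF T])+
  have "Q A T x b i j = a j * \<gamma> j * (U j i p q l m + U j i l m p q)
      - a i * \<gamma> i * (U i j p q l m + U i j l m p q)"
    by (simp add: Q_def b A' U_def numeral_eq_Suc swap algebra_simps)
  also have "\<dots> = mix_form \<gamma> (\<lambda>v. a j * k i v - a i * k j v) b i j"
    unfolding U
    by (simp add: mix_form_def b numeral_eq_Suc sum_distrib_left algebra_simps flip: sum.distrib sum_subtractf)
  finally show ?thesis .
qed

lemma Q_diag_diag:
  assumes A: "diag_form \<gamma> a x A" and B: "diag_form \<gamma> c x B" and b: "length b = 2"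
  shows "Q A B x b i j = \<gamma> i * \<gamma> j * (a j * c i - a i * c j) *
    (of_bool (b = [i, j]) + of_bool (b = [j, i]))"
proof -
  obtain p q where b: "b = [p, q]" using b by (auto simp: numeral_eq_Suc length_Suc_conv)
  show ?thesis using A B
    by (simp add: Q_def b diag_form_def lessThan_Suc numeral_eq_Suc) (auto simp: algebra_simps)
qed

lemma mix_form_cong: "(\<And>v. z v = z' v) \<Longrightarrow> mix_form \<gamma> z b i j = mix_form \<gamma> z' b i j"
  by (simp add: mix_form_def)

lemma mix_form_linear:
  "c * mix_form \<gamma> z b i j = mix_form \<gamma> (\<lambda>v. c * z v) b i j"
  "mix_form \<gamma> z b i j + mix_form \<gamma> z' b i j = mix_form \<gamma> (\<lambda>v. z v + z' v) b i j"
  "mix_form \<gamma> z b i j - mix_form \<gamma> z' b i j = mix_form \<gamma> (\<lambda>v. z v - z' v) b i j"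
  by (simp_all add: mix_form_def sum_distrib_left sum.distrib[symmetric] sum_subtractf[symmetric] algebra_simps)

text \<open>
  The minus sign comes from contracting the first with the third slot: the plane \<open>(i, h)\<close>
  enters \<open>R\<^sub>h\<^sub>i\<^sub>h\<^sub>i\<close> with \<open>- k i h\<close>.
\<close>
lemma ricci_plane_form:
  assumes g: "diag_at \<gamma> (g x)" and R: "plane_form \<gamma> k x (riemann g)"
  shows "diag_form \<gamma> (\<lambda>i. - (\<Sum>h\<in>UNIV - {i}. k i h)) x (ricci g)"
  unfolding diag_form_def
proof (intro allI)
  fix i j
  have nz: "\<gamma> i \<noteq> 0" for i using g by (auto simp: diag_at_def)
  have "ricci g x [i, j] = (\<Sum>h\<in>UNIV. \<Sum>l\<in>UNIV. (if h = l then riemann g x [h, i, h, j] / \<gamma> h else 0))"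
    unfolding ricci_def list.case by (intro sum.cong refl) (simp add: ginv_diag[where g=g, OF g])
  also have "\<dots> = (\<Sum>h\<in>UNIV. riemann g x [h, i, h, j] / \<gamma> h)" by simp
  also have "\<dots> = (\<Sum>h\<in>UNIV - {i}. - k i h * (if i = j then \<gamma> i else 0))"
  proof (rule sum.mono_neutral_cong_right)
    show "\<forall>h\<in>UNIV - (UNIV - {i}). riemann g x [h, i, h, j] / \<gamma> h = 0"
      by (simp add: plane_formD(1)[OF R])
    show "riemann g x [h, i, h, j] / \<gamma> h = - k i h * (if i = j then \<gamma> i else 0)" if "h \<in> UNIV - {i}" for h
      using that nz[of h] plane_formD(2)[OF R, of i h] by (auto simp: plane_formD(1)[OF R])
  qed auto
  also have "\<dots> = (if i = j then - (\<Sum>h\<in>UNIV - {i}. k i h) * \<gamma> i else 0)"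
    by (simp add: sum_distrib_right sum_negf)
  finally show "ricci g x [i, j] = (if i = j then - (\<Sum>h\<in>UNIV - {i}. k i h) * \<gamma> i else 0)" .
qed

lemma scalar_curvature_diag:
  assumes g: "diag_at \<gamma> (g x)" and S: "diag_form \<gamma> a x (ricci g)"
  shows "scalar_curvature g x = (\<Sum>i\<in>UNIV. a i)"
proof -
  have nz: "\<gamma> i \<noteq> 0" for i using g by (auto simp: diag_at_def)
  have "scalar_curvature g x = (\<Sum>i\<in>UNIV. \<Sum>j\<in>UNIV. (if i = j then a i else 0))"
    unfolding scalar_curvature_def
    by (intro sum.cong) (use nz S in \<open>auto simp: ginv_diag[where g=g, OF g] diag_form_def\<close>)
  then show ?thesis by simp
qed

lemma kulkarni_nomizu_diag:
  assumes "diag_form \<gamma> a x A" "diag_form \<gamma> c x B"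
  shows "plane_form \<gamma> (\<lambda>i j. a i * c j + a j * c i) x (kulkarni_nomizu A B)"
  using assms by (auto simp: plane_form_def diag_form_def kulkarni_nomizu_def algebra_simps)

lemma conformal_plane_form:
  fixes g :: "'n::finite metric"
  assumes g: "diag_at \<gamma> (g x)" and R: "plane_form \<gamma> k x (riemann g)"
    and S: "diag_form \<gamma> a x (ricci g)"
  shows "plane_form \<gamma> (\<lambda>i j. k i j + (a i + a j) / (real CARD('n) - 2)
      - (\<Sum>l\<in>UNIV. a l) / ((real CARD('n) - 1) * (real CARD('n) - 2))) x (conformal g)"
proof -
  have S': "diag_form \<gamma> (\<lambda>i. - a i) x (\<lambda>y c. - ricci g y c)"
    using S by (simp add: diag_form_def)
  note G = diag_form_metric[where g=g, OF g]
  note GS = kulkarni_nomizu_diag[OF G S'] and GG = kulkarni_nomizu_diag[OF G G]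
  have "conformal g x [h, i, j, l] =
      (k h i + (a h + a i) / (real CARD('n) - 2) - sum a UNIV / ((real CARD('n) - 1) * (real CARD('n) - 2)))
        * \<gamma> h * \<gamma> i * (of_bool (h = l \<and> i = j) - of_bool (h = j \<and> i = l))" for h i j l
  proof -
    define d :: real where "d = of_bool (h = l \<and> i = j) - of_bool (h = j \<and> i = l)"
    have "s / (2 * u * v) = (s / 2) / (u * v)" for s u v :: real by simp
    then show ?thesis
      unfolding conformal_def Let_def scalar_curvature_diag[where g=g, OF g S] plane_formD(1)[OF R]
       plane_formD(1)[OF GS] plane_formD(1)[OF GG] d_def[symmetric]
      by (simp only: divide_inverse) (simp add: algebra_simps)
  qed
  then show ?thesis
    using plane_formD(2)[OF R] by (auto simp: plane_form_def add.commute)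
qed

section \<open>Two-block curvature in dimension four\<close>

definition base_index :: "4 \<Rightarrow> bool" where
  "base_index i \<longleftrightarrow> i = 1 \<or> i = 2"

text \<open>
  The diagonal values are those of the respective block rather than zero. This makes
  \<open>block \<alpha> \<beta> \<delta> i v\<close> and \<open>block \<alpha> \<beta> \<delta> j v\<close> agree for every \<open>v\<close> when \<open>i\<close> and \<open>j\<close> lie in the same
  block.
\<close>
definition block :: "real \<Rightarrow> real \<Rightarrow> real \<Rightarrow> 4 \<Rightarrow> 4 \<Rightarrow> real" where
  "block \<alpha> \<beta> \<delta> i j =
    (if base_index i then (if base_index j then \<alpha> else \<beta>) else if base_index j then \<beta> else \<delta>)"

definition split_diag :: "real \<Rightarrow> real \<Rightarrow> 4 \<Rightarrow> real" where
  "split_diag a c i = (if base_index i then a else c)"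

lemma block_commute: "block \<alpha> \<beta> \<delta> i j = block \<alpha> \<beta> \<delta> j i"
  by (auto simp: block_def)

text \<open>
  When \<open>i\<close> and \<open>j\<close> lie in the same block, \<open>Q(g, Y)\<close> vanishes there because \<open>Y\<close> is invariant under
  rotations of that block; on mixed planes \<open>X\<close> has the value \<open>\<beta>\<close>. So one factor serves all planes.
\<close>
lemma dot_block_plane:
  assumes g: "diag_at \<gamma> (g x)" and X: "plane_form \<gamma> (block \<alpha> \<beta> \<delta>) x X"
    and Y: "plane_form \<gamma> (block \<alpha>' \<beta>' \<delta>') x Y" and b: "length b = 4"
  shows "dot g X Y x b i j = - \<beta> * Q (metric_tensor g) Y x b i j"
proof -
  have Q: "Q (metric_tensor g) Y x b i j =
      mix_form \<gamma> (\<lambda>v. block \<alpha>' \<beta>' \<delta>' i v - block \<alpha>' \<beta>' \<delta>' j v) b i j"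
    using Q_diag_plane[OF diag_form_metric[where g=g, OF g] Y b] by simp
  have "block \<alpha> \<beta> \<delta> i j = \<beta> \<or> (\<forall>v. block \<alpha>' \<beta>' \<delta>' i v = block \<alpha>' \<beta>' \<delta>' j v)"
    by (auto simp: block_def)
  then have "block \<alpha> \<beta> \<delta> i j = \<beta> \<or> Q (metric_tensor g) Y x b i j = 0"
    unfolding Q by (auto simp: mix_form_def)
  then show ?thesis
    unfolding dot_plane_form[where g=g, OF g X] by auto
qed

lemma dot_block_diag:
  assumes g: "diag_at \<gamma> (g x)" and X: "plane_form \<gamma> (block \<alpha> \<beta> \<delta>) x X"
    and A: "diag_form \<gamma> (split_diag a c) x A" and b: "length b = 2"
  shows "dot g X A x b i j = - \<beta> * Q (metric_tensor g) A x b i j"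
proof -
  have "block \<alpha> \<beta> \<delta> i j = \<beta> \<or> split_diag a c i = split_diag a c j"
    by (auto simp: block_def split_diag_def)
  moreover have "Q (metric_tensor g) A x b i j = 0" if "split_diag a c i = split_diag a c j"
    unfolding Q_diag_diag[OF diag_form_metric[where g=g, OF g] A b] that by simp
  ultimately have "block \<alpha> \<beta> \<delta> i j = \<beta> \<or> Q (metric_tensor g) A x b i j = 0" by blast
  then show ?thesis
    unfolding dot_plane_form[where g=g, OF g X] by auto
qed

context
  fixes g :: "4 metric" and x :: "real ^ 4" and \<gamma> :: "4 \<Rightarrow> real" and \<alpha> \<beta> \<delta> \<mu> :: real
  assumes \<mu>: "\<mu> = (\<alpha> + \<delta> - 2 * \<beta>) / 6"
    and g: "diag_at \<gamma> (g x)" and R: "plane_form \<gamma> (block \<alpha> \<beta> \<delta>) x (riemann g)"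
begin

lemma ricci_block: "diag_form \<gamma> (split_diag (- (\<alpha> + 2 * \<beta>)) (- (\<delta> + 2 * \<beta>))) x (ricci g)"
proof -
  have "- (\<Sum>h\<in>UNIV - {i}. block \<alpha> \<beta> \<delta> i h) = split_diag (- (\<alpha> + 2 * \<beta>)) (- (\<delta> + 2 * \<beta>)) i" for i
    using exhaust_4[of i] by (elim disjE) (simp_all add: sum_diff1 sum_4 block_def split_diag_def base_index_def)
  then show ?thesis using ricci_plane_form[where g=g, OF g R] by simp
qed

text \<open>
  Tracelessness leaves a single free number: the values \<open>p\<close>, \<open>q\<close>, \<open>s\<close> of \<open>C\<close> satisfy
  \<open>p + 2 q = 0 = s + 2 q\<close>.
\<close>
lemma conformal_block:
  "plane_form \<gamma> (block (2 * \<mu>) (- \<mu>) (2 * \<mu>)) x (conformal g)"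
proof -
  let ?\<rho> = "split_diag (- (\<alpha> + 2 * \<beta>)) (- (\<delta> + 2 * \<beta>))"
  have "block \<alpha> \<beta> \<delta> i j + (?\<rho> i + ?\<rho> j) / (real CARD(4) - 2)
      - (\<Sum>l\<in>UNIV. ?\<rho> l) / ((real CARD(4) - 1) * (real CARD(4) - 2)) =
      block (2 * \<mu>) (- \<mu>) (2 * \<mu>) i j" for i j
    by (auto simp: block_def split_diag_def sum_4 base_index_def \<mu> field_simps)
  then show ?thesis
    using conformal_plane_form[where g=g, OF g R ricci_block] by simp
qed

text \<open>
  On mixed planes the left-hand side has weight \<open>\<alpha> \<delta> - \<beta>\<^sup>2\<close> for one block of \<open>v\<close> and its negative for
  the other; the corresponding weights of \<open>Q(g, C)\<close> are \<open>3 \<mu>\<close> and \<open>- 3 \<mu>\<close>.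
\<close>
lemma dot_riemann_riemann_block:
  assumes "\<mu> \<noteq> 0" and b: "length b = 4"
  shows "dot g (riemann g) (riemann g) x b i j - Q (ricci g) (riemann g) x b i j =
    (\<alpha> * \<delta> - \<beta>^2) / (3 * \<mu>) * Q (metric_tensor g) (conformal g) x b i j"
proof -
  note G = diag_form_metric[where g=g, OF g]
  show ?thesis
    unfolding dot_block_plane[where g=g, OF g R R b] Q_diag_plane[OF G R b] Q_diag_plane[OF G conformal_block b]
      Q_diag_plane[OF ricci_block R b] mix_form_linear
  proof (rule mix_form_cong)
    fix v
    let ?\<rho> = "split_diag (- (\<alpha> + 2 * \<beta>)) (- (\<delta> + 2 * \<beta>))" and ?R = "block \<alpha> \<beta> \<delta>" and ?C = "block (2 * \<mu>) (- \<mu>) (2 * \<mu>)"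
    show "- \<beta> * (1 * ?R i v - 1 * ?R j v) -
        (?\<rho> j * ?R i v - ?\<rho> i * ?R j v) =
        (\<alpha> * \<delta> - \<beta>\<^sup>2) / (3 * \<mu>) * (1 * ?C i v - 1 * ?C j v)"
      using assms(1)
      by (cases "base_index i"; cases "base_index j"; cases "base_index v")
        (simp_all add: block_def split_diag_def power2_eq_square field_simps)
  qed
qed

text \<open>
  Both scalar equations come down to the fact that the two Ricci values \<open>- (\<alpha> + 2 \<beta>)\<close> and
  \<open>- (\<delta> + 2 \<beta>)\<close> add up to half of the scalar curvature \<open>\<kappa>\<close>; the coefficient of \<open>Q(g, C)\<close>
  is \<open>- \<kappa> / 3\<close>.
\<close>
lemma dot_conformal_riemann_commutator_conformal:
  assumes b: "length b = 4"
  shows "dot g (conformal g) (riemann g) x b i j - dot g (riemann g) (conformal g) x b i j =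
    2 * (\<alpha> + \<delta> + 4 * \<beta>) / 3 * Q (metric_tensor g) (conformal g) x b i j + Q (ricci g) (conformal g) x b i j"
proof -
  note G = diag_form_metric[where g=g, OF g]
  show ?thesis
    unfolding dot_block_plane[where g=g, OF g R conformal_block b] dot_block_plane[where g=g, OF g conformal_block R b]
      Q_diag_plane[OF G R b] Q_diag_plane[OF G conformal_block b]
      Q_diag_plane[OF ricci_block conformal_block b] mix_form_linear
  proof (rule mix_form_cong)
    fix v
    let ?\<rho> = "split_diag (- (\<alpha> + 2 * \<beta>)) (- (\<delta> + 2 * \<beta>))" and ?R = "block \<alpha> \<beta> \<delta>" and ?C = "block (2 * \<mu>) (- \<mu>) (2 * \<mu>)"
    show "- (- \<mu>) * (1 * ?R i v - 1 * ?R j v) - - \<beta> * (1 * ?C i v - 1 * ?C j v) =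
        2 * (\<alpha> + \<delta> + 4 * \<beta>) / 3 * (1 * ?C i v - 1 * ?C j v) +
        (?\<rho> j * ?C i v - ?\<rho> i * ?C j v)"
      by (cases "base_index i"; cases "base_index j"; cases "base_index v")
        (simp_all add: block_def split_diag_def \<mu> field_simps)
  qed
qed

text \<open>
  Two unknown coefficients \<open>L\<^sub>1\<close>, \<open>L\<^sub>2\<close> and two equations, one for \<open>v\<close> in the base and one for \<open>v\<close>
  in the fibre. Their sum is a multiple, by \<open>\<alpha> - \<delta>\<close>, of \<open>L\<^sub>1 = \<mu> + \<beta> L\<^sub>2\<close>; with this relation each of
  them becomes \<open>(\<alpha> \<delta> - \<beta>\<^sup>2) L\<^sub>2 = - 3 \<beta> \<mu>\<close>, and \<open>L\<close> is its solution.
\<close>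
lemma dot_conformal_riemann_commutator_riemann:
  assumes "\<alpha> * \<delta> \<noteq> \<beta>^2" and b: "length b = 4"
  defines "L \<equiv> - 3 * \<beta> * \<mu> / (\<alpha> * \<delta> - \<beta>^2)"
  shows "dot g (conformal g) (riemann g) x b i j - dot g (riemann g) (conformal g) x b i j =
    (\<mu> + \<beta> * L) * Q (metric_tensor g) (riemann g) x b i j + L * Q (ricci g) (riemann g) x b i j"
proof -
  note G = diag_form_metric[where g=g, OF g]
  \<comment> \<open>The defining relation of \<open>L\<close>, free of division, so that each case below is a polynomial identity.\<close>
  have L: "L * (\<alpha> * \<delta>) = L * (\<beta> * \<beta>) - 3 * \<beta> * \<mu>"
    using assms(1) by (simp add: L_def field_simps power2_eq_square)
  show ?thesis
    unfolding dot_block_plane[where g=g, OF g R conformal_block b] dot_block_plane[where g=g, OF g conformal_block R b]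
      Q_diag_plane[OF G R b] Q_diag_plane[OF G conformal_block b]
      Q_diag_plane[OF ricci_block R b] mix_form_linear
  proof (rule mix_form_cong)
    fix v
    let ?\<rho> = "split_diag (- (\<alpha> + 2 * \<beta>)) (- (\<delta> + 2 * \<beta>))" and ?R = "block \<alpha> \<beta> \<delta>" and ?C = "block (2 * \<mu>) (- \<mu>) (2 * \<mu>)"
    show "- (- \<mu>) * (1 * ?R i v - 1 * ?R j v) - - \<beta> * (1 * ?C i v - 1 * ?C j v) =
        (\<mu> + \<beta> * L) * (1 * ?R i v - 1 * ?R j v) +
        L * (?\<rho> j * ?R i v - ?\<rho> i * ?R j v)"
      using L
      by (cases "base_index i"; cases "base_index j"; cases "base_index v")
        (simp_all add: block_def split_diag_def algebra_simps)
  qed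
qed

end

section \<open>Partial derivatives\<close>

lemma partial_eqI:
  "((\<lambda>s. h (x + s *\<^sub>R axis i 1)) has_real_derivative d) (at 0) \<Longrightarrow> partial i h x = d"
  unfolding partial_def by (rule DERIV_imp_deriv)

lemma eventually_shift_in_open:
  assumes "open D" "x \<in> D"
  shows "\<forall>\<^sub>F s in nhds 0. x + s *\<^sub>R axis i (1::real) \<in> (D :: (real ^ 'n::finite) set)"
proof -
  have "((\<lambda>s. x + s *\<^sub>R axis i 1) \<longlongrightarrow> x + 0 *\<^sub>R axis i (1::real)) (nhds (0::real))"
    by (intro tendsto_intros filterlim_ident)
  then show ?thesis using assms by (simp add: topological_tendstoD)
qed

text \<open>
  Needed because the closed form of the Christoffel symbols is only valid where the metric is
  regular, while their derivatives look at a neighbourhood.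
\<close>
lemma partial_cong:
  assumes "open D" "x \<in> D" "\<And>y. y \<in> D \<Longrightarrow> h y = h' y"
  shows "partial i h x = partial i h' x"
  unfolding partial_def
  by (rule deriv_cong_ev)
    (use eventually_shift_in_open[OF assms(1,2)] in eventually_elim, use assms(3) in auto)

lemma shifted_component_product_deriv:
  fixes x :: "real ^ 'n::finite"
  assumes "m \<noteq> n" "(p has_real_derivative p') (at (x $ m))" "(q has_real_derivative q') (at (x $ n))"
  shows "((\<lambda>s. p ((x + s *\<^sub>R axis i 1) $ m) * q ((x + s *\<^sub>R axis i 1) $ n)) has_real_derivative
     (if i = m then p' * q (x $ n) else if i = n then p (x $ m) * q' else 0)) (at 0)"
proof -
  have *: "((\<lambda>s. x $ l + s * axis i 1 $ l) has_real_derivative axis i 1 $ l) (at 0)" for l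
    by (auto intro!: derivative_eq_intros)
  have p: "((\<lambda>s. p (x $ m + s * axis i 1 $ m)) has_real_derivative p' * axis i 1 $ m) (at 0)"
    using DERIV_chain2[OF _ *, of p p' m] assms(2) by simp
  have q: "((\<lambda>s. q (x $ n + s * axis i 1 $ n)) has_real_derivative q' * axis i 1 $ n) (at 0)"
    using DERIV_chain2[OF _ *, of q q' n] assms(3) by simp
  show ?thesis
    using DERIV_mult[OF p q] assms(1) by (auto simp: axis_def mult.commute)
qed

lemma partial_product:
  fixes x :: "real ^ 'n::finite"
  assumes "m \<noteq> n" "(p has_real_derivative p') (at (x $ m))" "(q has_real_derivative q') (at (x $ n))"
  shows "partial i (\<lambda>y. p (y $ m) * q (y $ n)) x =
     (if i = m then p' * q (x $ n) else if i = n then p (x $ m) * q' else 0)"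
  by (rule partial_eqI[OF shifted_component_product_deriv[OF assms]])

text \<open>
  The family of functions \<open>c + a / x\<^sub>l\<^sup>m + b / x\<^sub>l\<^sup>n\<close> is closed under partial derivatives, so the
  induction over the order of differentiability stays inside it. The function \<open>h\<close> is only
  required to agree with such an expression on \<open>S\<close>, because \<open>partial i h\<close> is known only there.
\<close>
lemma Ck_on_inverse_powers:
  fixes m n :: nat
  assumes S: "open S" "\<And>x. x \<in> S \<Longrightarrow> x $ l > 0"
    and h: "\<And>x. x \<in> S \<Longrightarrow> h x = c + a / (x $ l) ^ m + b / (x $ l) ^ n"
  shows "Ck_on k S (h :: real ^ 'n::finite \<Rightarrow> real)"
  using h
proof (induction k arbitrary: h a b c m n)
  case (0 h a b c m n)
  have "continuous_on S (\<lambda>x. c + a / (x $ l) ^ m + b / (x $ l) ^ n)"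
    using S(2) by (force intro!: continuous_intros)
  then show ?case using 0 by (simp cong: continuous_on_cong)
next
  case (Suc k h a b c m n)
  define h' where "h' i x = (if i = l then - (of_nat m * a) else 0) / (x $ l) ^ Suc m
        + (if i = l then - (of_nat n * b) else 0) / (x $ l) ^ Suc n" for i x
  have d: "((\<lambda>s. h (x + s *\<^sub>R axis i 1)) has_real_derivative h' i x) (at 0)" if x: "x \<in> S" for x i
  proof -
    have pos: "x $ l > 0" using S(2)[OF x] .
    have "((\<lambda>s. c + a / ((x + s *\<^sub>R axis i 1) $ l) ^ m + b / ((x + s *\<^sub>R axis i 1) $ l) ^ n)
        has_real_derivative h' i x) (at 0)"
    proof (cases "i = l")
      case True
      have *: "((\<lambda>s. e / (x $ l + s) ^ j) has_real_derivative - (of_nat j * e) / (x $ l) ^ Suc j) (at 0)" for e j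
        using pos
        by (auto intro!: derivative_eq_intros) (simp add: divide_simps, cases j, simp_all add: algebra_simps)
      show ?thesis
        using DERIV_add[OF DERIV_add[OF DERIV_const[of c] *[of a m]] *[of b n]] True
        by (simp add: h'_def axis_def)
    next
      case False
      then show ?thesis by (simp add: h'_def axis_def)
    qed
    moreover have "\<forall>\<^sub>F s in nhds 0. c + a / ((x + s *\<^sub>R axis i 1) $ l) ^ m + b / ((x + s *\<^sub>R axis i 1) $ l) ^ n
        = h (x + s *\<^sub>R axis i 1)"
      using eventually_shift_in_open[OF S(1) x, of i] by eventually_elim (simp only: Suc.prems)
    ultimately show ?thesis by (simp only: DERIV_cong_ev[OF refl _ refl])
  qed
  have "Ck_on k S (partial i h)" for i
    by (rule Suc.IH[where c = 0 and m = "Suc m" and n = "Suc n"])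
      (simp only: partial_eqI[OF d] h'_def add_0)
  moreover have "Ck_on 0 S h"
  proof -
    have "continuous_on S (\<lambda>x. c + a / (x $ l) ^ m + b / (x $ l) ^ n)"
      using S(2) by (force intro!: continuous_intros)
    then show ?thesis using Suc.prems by (simp cong: continuous_on_cong)
  qed
  ultimately show ?case using d by (auto simp: real_differentiable_def)
qed

section \<open>Curvature of static spherically symmetric metrics\<close>

text \<open>The static spherically symmetric metric \<open>- F dt\<^sup>2 + dr\<^sup>2 / F + r\<^sup>2 (d\<theta>\<^sup>2 + sin\<^sup>2 \<theta> d\<phi>\<^sup>2)\<close>.\<close>
definition sss_metric :: "(real \<Rightarrow> real) \<Rightarrow> 4 metric" where
  "sss_metric F x = (\<chi> i j.
     if i \<noteq> j then 0
     else if i = 1 then - F (x $ 2)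
     else if i = 2 then 1 / F (x $ 2)
     else if i = 3 then (x $ 2)^2
     else (x $ 2)^2 * (sin (x $ 3))^2)"

definition sss_diag :: "(real \<Rightarrow> real) \<Rightarrow> real ^ 4 \<Rightarrow> 4 \<Rightarrow> real" where
  "sss_diag F x i = (if i = 1 then - F (x $ 2) else if i = 2 then 1 / F (x $ 2)
     else if i = 3 then (x $ 2)^2 else (x $ 2)^2 * (sin (x $ 3))^2)"

definition sss_domain :: "(real \<Rightarrow> real) \<Rightarrow> (real ^ 4) set" where
  "sss_domain F = {x. x $ 2 > 0 \<and> F (x $ 2) \<noteq> 0 \<and> 0 < x $ 3 \<and> x $ 3 < pi}"

text \<open>
  Each Christoffel symbol \<open>\<Gamma>\<^sup>k\<^sub>i\<^sub>j\<close> of this metric is a function of \<open>r\<close> times a function of \<open>\<theta>\<close>: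
  \<open>chr_rad\<close> and \<open>chr_ang\<close> are the two factors, \<open>chr_rad'\<close> and \<open>chr_ang'\<close> their derivatives.
\<close>
definition chr_rad :: "(real \<Rightarrow> real) \<Rightarrow> (real \<Rightarrow> real) \<Rightarrow> 4 \<Rightarrow> 4 \<Rightarrow> 4 \<Rightarrow> real \<Rightarrow> real" where
  "chr_rad F F' k i j r =
    (if k = 1 then (if {i, j} = {1, 2} then F' r / (2 * F r) else 0)
     else if k = 2 then
       (if i \<noteq> j then 0 else if i = 1 then F r * F' r / 2 else if i = 2 then - F' r / (2 * F r) else - r * F r)
     else if k = 3 then (if {i, j} = {2, 3} then 1 / r else if i = 4 \<and> j = 4 then 1 else 0)
     else (if {i, j} = {2, 4} then 1 / r else if {i, j} = {3, 4} then 1 else 0))"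

definition chr_ang :: "4 \<Rightarrow> 4 \<Rightarrow> 4 \<Rightarrow> real \<Rightarrow> real" where
  "chr_ang k i j \<theta> =
    (if k = 2 \<and> i = 4 \<and> j = 4 then (sin \<theta>)^2
     else if k = 3 \<and> i = 4 \<and> j = 4 then - (sin \<theta> * cos \<theta>)
     else if k = 4 \<and> {i, j} = {3, 4} then cos \<theta> / sin \<theta> else 1)"

definition chr_rad' :: "(real \<Rightarrow> real) \<Rightarrow> (real \<Rightarrow> real) \<Rightarrow> (real \<Rightarrow> real) \<Rightarrow> 4 \<Rightarrow> 4 \<Rightarrow> 4 \<Rightarrow> real \<Rightarrow> real" where
  "chr_rad' F F' F'' k i j r =
    (if k = 1 then (if {i, j} = {1, 2} then (F'' r * F r - (F' r)^2) / (2 * (F r)^2) else 0)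
     else if k = 2 then
       (if i \<noteq> j then 0 else if i = 1 then ((F' r)^2 + F r * F'' r) / 2
        else if i = 2 then - (F'' r * F r - (F' r)^2) / (2 * (F r)^2) else - F r - r * F' r)
     else if k = 3 then (if {i, j} = {2, 3} then - 1 / r^2 else 0)
     else (if {i, j} = {2, 4} then - 1 / r^2 else 0))"

definition chr_ang' :: "4 \<Rightarrow> 4 \<Rightarrow> 4 \<Rightarrow> real \<Rightarrow> real" where
  "chr_ang' k i j \<theta> =
    (if k = 2 \<and> i = 4 \<and> j = 4 then 2 * sin \<theta> * cos \<theta>
     else if k = 3 \<and> i = 4 \<and> j = 4 then (sin \<theta>)^2 - (cos \<theta>)^2
     else if k = 4 \<and> {i, j} = {3, 4} then - 1 / (sin \<theta>)^2 else 0)"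

context
  fixes F F' F'' :: "real \<Rightarrow> real"
  assumes F': "\<And>r. r > 0 \<Longrightarrow> (F has_real_derivative F' r) (at r)"
    and F'': "\<And>r. r > 0 \<Longrightarrow> (F' has_real_derivative F'' r) (at r)"
begin

lemma open_sss_domain: "open (sss_domain F)"
proof -
  define U where "U = {0<..} \<inter> F -` (- {0})"
  have "continuous_on {0<..} F"
    using F' by (auto intro!: continuous_at_imp_continuous_on DERIV_isCont)
  then have "open U"
    unfolding U_def by (rule continuous_open_preimage) (auto simp: open_Compl)
  then have "open ((\<lambda>x::real^4. x $ 2) -` U \<inter> (\<lambda>x. x $ 3) -` {0<..<pi})"
    by (intro open_Int open_vimage continuous_intros open_greaterThanLessThan)
  also have "(\<lambda>x::real^4. x $ 2) -` U \<inter> (\<lambda>x. x $ 3) -` {0<..<pi} = sss_domain F"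
    by (auto simp: sss_domain_def U_def)
  finally show ?thesis .
qed

lemma sss_domain_facts:
  assumes "x \<in> sss_domain F"
  shows "x $ 2 > 0" "F (x $ 2) \<noteq> 0" "sin (x $ 3) \<noteq> 0"
  using assms sin_gt_zero[of "x $ 3"] by (auto simp: sss_domain_def)

lemma sss_metric_diag: "sss_metric F x = (\<chi> i j. if i = j then sss_diag F x i else 0)"
  by (auto simp: sss_metric_def sss_diag_def vec_eq_iff)

lemma partial_sss_metric:
  assumes x: "x \<in> sss_domain F"
  shows "partial l (\<lambda>y. sss_metric F y $ i $ j) x =
    (if i \<noteq> j then 0
     else if l = 2 then (if i = 1 then - F' (x $ 2) else if i = 2 then - F' (x $ 2) / (F (x $ 2))^2
       else if i = 3 then 2 * x $ 2 else 2 * x $ 2 * (sin (x $ 3))^2)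
     else if l = 3 \<and> i = 4 then (x $ 2)^2 * (2 * sin (x $ 3) * cos (x $ 3)) else 0)"
proof -
  note d = sss_domain_facts[OF x]
  define p where "p = (\<lambda>r. if i \<noteq> j then 0 else if i = 1 then - F r else if i = 2 then 1 / F r else r^2)"
  define q where "q = (\<lambda>\<theta>::real. if i = 4 then (sin \<theta>)^2 else 1)"
  define p' where "p' = (if i \<noteq> j then 0 else if i = 1 then - F' (x $ 2)
      else if i = 2 then - F' (x $ 2) / (F (x $ 2))^2 else 2 * x $ 2)"
  define q' where "q' = (if i = 4 then 2 * sin (x $ 3) * cos (x $ 3) else 0)"
  have p: "(p has_real_derivative p') (at (x $ 2))"
    unfolding p_def p'_def using d
    by (auto intro!: derivative_eq_intros F' simp: power2_eq_square)
  have q: "(q has_real_derivative q') (at (x $ 3))"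
    unfolding q_def q'_def by (auto intro!: derivative_eq_intros)
  have "(\<lambda>y. sss_metric F y $ i $ j) = (\<lambda>y. p (y $ 2) * q (y $ 3))"
    using exhaust_4[of i] by (auto simp: sss_metric_def p_def q_def fun_eq_iff)
  then show ?thesis
    using partial_product[of 2 3, OF _ p q, of l] exhaust_4[of i]
    by (auto simp: p_def q_def p'_def q'_def)
qed

lemma diag_at_sss_metric:
  assumes x: "x \<in> sss_domain F"
  shows "diag_at (sss_diag F x) (sss_metric F x)"
  using sss_domain_facts[OF x] by (auto simp: diag_at_def sss_metric_diag sss_diag_def)

lemma christoffel_sss_metric:
  assumes x: "x \<in> sss_domain F"
  shows "christoffel (sss_metric F) k i j x = chr_rad F F' k i j (x $ 2) * chr_ang k i j (x $ 3)"
proof -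
  note d = sss_domain_facts[OF x]
  define P where "P i j l = partial i (\<lambda>y. sss_metric F y $ j $ l) x" for i j l
  have "christoffel (sss_metric F) k i j x =
      (1/2) * (\<Sum>l\<in>UNIV. if k = l then (P i j k + P j i k - P k i j) / sss_diag F x k else 0)"
    unfolding christoffel_def P_def[symmetric]
    by (intro arg_cong[where f = "\<lambda>z. (1/2) * z"] sum.cong refl)
      (simp add: ginv_diag[where g = "sss_metric F", OF diag_at_sss_metric[OF x]])
  also have "\<dots> = (P i j k + P j i k - P k i j) / (2 * sss_diag F x k)" by simp
  also have "\<dots> = chr_rad F F' k i j (x $ 2) * chr_ang k i j (x $ 3)"
    using exhaust_4[of k] exhaust_4[of i] exhaust_4[of j] d
    by (elim disjE) (simp_all add: P_def partial_sss_metric[OF x] sss_diag_def chr_rad_def chr_ang_def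
        doubleton_eq_iff power2_eq_square field_simps)
  finally show ?thesis .
qed

lemma chr_rad_deriv:
  assumes "r > 0" "F r \<noteq> 0"
  shows "(chr_rad F F' k i j has_real_derivative chr_rad' F F' F'' k i j r) (at r)"
  using exhaust_4[of k] exhaust_4[of i] exhaust_4[of j] assms
  by (elim disjE; simp add: chr_rad_def[abs_def] chr_rad'_def doubleton_eq_iff;
      auto intro!: derivative_eq_intros F' F'' simp: power2_eq_square field_simps)

lemma chr_ang_deriv:
  assumes "sin \<theta> \<noteq> 0"
  shows "(chr_ang k i j has_real_derivative chr_ang' k i j \<theta>) (at \<theta>)"
proof -
  have c: "cos \<theta> * cos \<theta> = 1 - sin \<theta> * sin \<theta>"
    using sin_cos_squared_add[of \<theta>] by (simp add: power2_eq_square)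
  show ?thesis
    using exhaust_4[of k] exhaust_4[of i] exhaust_4[of j] assms
    by (elim disjE; simp add: chr_ang_def[abs_def] chr_ang'_def doubleton_eq_iff;
      auto intro!: derivative_eq_intros simp: power2_eq_square field_simps c)
qed

lemma partial_christoffel_sss_metric:
  assumes x: "x \<in> sss_domain F"
  shows "partial l (christoffel (sss_metric F) k i j) x =
    (if l = 2 then chr_rad' F F' F'' k i j (x $ 2) * chr_ang k i j (x $ 3)
     else if l = 3 then chr_rad F F' k i j (x $ 2) * chr_ang' k i j (x $ 3) else 0)"
proof -
  note d = sss_domain_facts[OF x]
  have "partial l (christoffel (sss_metric F) k i j) x =
      partial l (\<lambda>y. chr_rad F F' k i j (y $ 2) * chr_ang k i j (y $ 3)) x"
    by (rule partial_cong[OF open_sss_domain x christoffel_sss_metric])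
  also have "\<dots> = (if l = 2 then chr_rad' F F' F'' k i j (x $ 2) * chr_ang k i j (x $ 3)
     else if l = 3 then chr_rad F F' k i j (x $ 2) * chr_ang' k i j (x $ 3) else 0)"
    by (rule partial_product[OF _ chr_rad_deriv chr_ang_deriv]) (use d in auto)
  finally show ?thesis .
qed

text \<open>
  The sectional curvatures of the warped product: \<open>- F'' / 2\<close> is the Gauss curvature of the
  \<open>(t, r)\<close>-plane, \<open>(1 - F) / r\<^sup>2\<close> is the curvature of the sphere of radius \<open>r\<close>
  minus \<open>|grad r|\<^sup>2 / r\<^sup>2\<close>, where \<open>|grad r|\<^sup>2 = F\<close>, and the mixed value is that of \<open>- Hess r / r\<close>.
\<close>
lemma riemann_sss_metric:
  assumes x: "x \<in> sss_domain F"
  shows "plane_form (sss_diag F x)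
    (block (- F'' (x $ 2) / 2) (- F' (x $ 2) / (2 * x $ 2)) ((1 - F (x $ 2)) / (x $ 2)^2))
    x (riemann (sss_metric F))" (is "plane_form _ ?k _ _")
proof -
  note d = sss_domain_facts[OF x]
  have c: "cos (x $ 3) * cos (x $ 3) = 1 - sin (x $ 3) * sin (x $ 3)"
    using sin_cos_squared_add[of "x $ 3"] by (simp add: power2_eq_square)
  have "riemann (sss_metric F) x [h, i, j, l] = ?k h i * sss_diag F x h * sss_diag F x i *
      (of_bool (h = l \<and> i = j) - of_bool (h = j \<and> i = l))" for h i j l
  proof -
    define K where "K = sss_diag F x h *
        (partial l (christoffel (sss_metric F) h i j) x - partial j (christoffel (sss_metric F) h i l) x
         + (\<Sum>\<beta>\<in>UNIV. christoffel (sss_metric F) \<beta> i j x * christoffel (sss_metric F) h \<beta> l x)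
         - (\<Sum>\<beta>\<in>UNIV. christoffel (sss_metric F) \<beta> i l x * christoffel (sss_metric F) h \<beta> j x))"
    have "riemann (sss_metric F) x [h, i, j, l] = (\<Sum>\<alpha>\<in>UNIV. if h = \<alpha> then K else 0)"
      unfolding riemann_def list.case K_def sss_metric_diag
      by (intro sum.cong refl) simp
    also have "\<dots> = K" by simp
    also have "\<dots> = ?k h i * sss_diag F x h * sss_diag F x i *
      (of_bool (h = l \<and> i = j) - of_bool (h = j \<and> i = l))"
      unfolding K_def partial_christoffel_sss_metric[OF x] christoffel_sss_metric[OF x] sum_4
      \<comment> \<open>The 256 components are checked one by one.\<close>
      using exhaust_4[of h] exhaust_4[of i] exhaust_4[of j] exhaust_4[of l] d
      by (elim disjE) (simp_all add: sss_diag_def block_def base_index_def chr_rad_def chr_ang_def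
        chr_rad'_def chr_ang'_def doubleton_eq_iff power2_eq_square field_simps c)
    finally show ?thesis .
  qed
  then show ?thesis by (auto simp: plane_form_def block_commute)
qed

end

section \<open>The Reissner-Nordstroem-de Sitter metric\<close>

lemma rnds_f_deriv:
  assumes "r > 0"
  shows "(rnds_f M e \<Lambda> has_real_derivative 2 * M / r^2 - 2 * e^2 / r^3 - 2 * \<Lambda> * r) (at r)"
    "((\<lambda>r. 2 * M / r^2 - 2 * e^2 / r^3 - 2 * \<Lambda> * r) has_real_derivative
       - 4 * M / r^3 + 6 * e^2 / r^4 - 2 * \<Lambda>) (at r)"
  unfolding rnds_f_def[abs_def] using assms
  by (auto intro!: derivative_eq_intros simp: field_simps eval_nat_numeral)

lemma rnds_metric_sss: "rnds_metric M e \<Lambda> = sss_metric (rnds_f M e \<Lambda>)"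
  by (simp add: fun_eq_iff rnds_metric_def sss_metric_def)

lemma rnds_domain_sss: "rnds_domain M e \<Lambda> = sss_domain (rnds_f M e \<Lambda>)"
  by (simp add: rnds_domain_def sss_domain_def)

text \<open>
  The pure \<open>\<Lambda>\<close> part is the constant curvature \<open>\<Lambda>\<close>; mass and charge cause the differences between
  the three values.
\<close>
lemma rnds_curvature:
  assumes x: "x \<in> rnds_domain M e \<Lambda>"
  defines "r \<equiv> x $ 2"
  shows "diag_at (sss_diag (rnds_f M e \<Lambda>) x) (rnds_metric M e \<Lambda> x)"
    "plane_form (sss_diag (rnds_f M e \<Lambda>) x)
      (block ((2 * M * r - 3 * e^2 + \<Lambda> * r^4) / r^4) ((e^2 - M * r + \<Lambda> * r^4) / r^4)
        ((2 * M * r - e^2 + \<Lambda> * r^4) / r^4)) x (riemann (rnds_metric M e \<Lambda>))"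
proof -
  let ?F' = "\<lambda>r. 2 * M / r^2 - 2 * e^2 / r^3 - 2 * \<Lambda> * r"
  let ?F'' = "\<lambda>r. - 4 * M / r^3 + 6 * e^2 / r^4 - 2 * \<Lambda>"
  have x': "x \<in> sss_domain (rnds_f M e \<Lambda>)" using x by (simp add: rnds_domain_sss)
  have r: "r > 0" using x by (simp add: r_def rnds_domain_def)
  show "diag_at (sss_diag (rnds_f M e \<Lambda>) x) (rnds_metric M e \<Lambda> x)"
    unfolding rnds_metric_sss by (rule diag_at_sss_metric[OF rnds_f_deriv x'])
  have "(2 * M * r - 3 * e^2 + \<Lambda> * r^4) / r^4 = - ?F'' r / 2"
    "(e^2 - M * r + \<Lambda> * r^4) / r^4 = - ?F' r / (2 * r)"
    "(2 * M * r - e^2 + \<Lambda> * r^4) / r^4 = (1 - rnds_f M e \<Lambda> r) / r^2"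
    using r by (simp_all add: rnds_f_def field_simps eval_nat_numeral)
  then show "plane_form (sss_diag (rnds_f M e \<Lambda>) x)
      (block ((2 * M * r - 3 * e^2 + \<Lambda> * r^4) / r^4) ((e^2 - M * r + \<Lambda> * r^4) / r^4)
        ((2 * M * r - e^2 + \<Lambda> * r^4) / r^4)) x (riemann (rnds_metric M e \<Lambda>))"
    unfolding rnds_metric_sss r_def
    by (simp only: riemann_sss_metric[OF rnds_f_deriv x'])
qed

theorem proposition3p2:
  fixes M e \<Lambda> :: real
    and gm :: "4 metric" and g R Ric C :: "4 tensor_field" and D :: "(real ^ 4) set"
  assumes "e \<noteq> 0" and "\<Lambda> > 0"
    and "gm = rnds_metric M e \<Lambda>" and "D = rnds_domain M e \<Lambda>"
    and "g = metric_tensor gm" and "R = riemann gm" and "Ric = ricci gm" and "C = conformal gm"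
  shows "
    ((\<forall>x\<in>D. \<forall>b i j. length b = 4 \<longrightarrow> (let r = x $ 2 in
        dot gm R C x b i j = - ((e^2 - M * r + \<Lambda> * r^4) / r^4) * Q g C x b i j))
      \<and> pseudosymmetric_wrt D gm R 4 C)
    \<and>
    ((\<forall>x\<in>D. \<forall>b i j. length b = 2 \<longrightarrow> (let r = x $ 2 in
        dot gm C Ric x b i j = (M * r - e^2) / r^4 * Q g Ric x b i j))
      \<and> pseudosymmetric_wrt D gm C 2 Ric)
    \<and>
    ((\<forall>x\<in>D. \<forall>b i j. length b = 4 \<longrightarrow> (let r = x $ 2 in
        dot gm C C x b i j = (M * r - e^2) / r^4 * Q g C x b i j \<and>
        dot gm C R x b i j = (M * r - e^2) / r^4 * Q g R x b i j))
      \<and> pseudosymmetric_wrt D gm C 4 C \<and> pseudosymmetric_wrt D gm C 4 R)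
    \<and>
    (\<forall>x\<in>D. \<forall>b i j. length b = 4 \<longrightarrow> (let r = x $ 2 in
        M * r - e^2 \<noteq> 0 \<longrightarrow>
        dot gm R R x b i j - Q Ric R x b i j =
          (2 * e^4 - 6 * e^2 * M * r + 3 * M^2 * r^2 - 6 * \<Lambda> * e^2 * r^4 + 6 * M * \<Lambda> * r^5)
            / (3 * r^4 * (M * r - e^2)) * Q g C x b i j))
    \<and>
    (\<forall>x\<in>D. \<forall>b i j. length b = 4 \<longrightarrow>
       (let r = x $ 2;
            Y2 = - M * r + \<Lambda> * r^4 + e^2;
            Y6 = M * r - e^2;
            N = 3 * M * r * (M * r - 2 * e^2) + 6 * \<Lambda> * r^4 * Y6 + 2 * e^4;
            L1 = Y6 / r^4 * (1 - 3 * Y2^2 / N);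
            L2 = - (3 * Y6 * Y2) / N
        in N \<noteq> 0 \<longrightarrow>
           dot gm C R x b i j - dot gm R C x b i j = L1 * Q g R x b i j + L2 * Q Ric R x b i j))
    \<and>
    (\<forall>x\<in>D. \<forall>b i j. length b = 4 \<longrightarrow>
        dot gm C R x b i j - dot gm R C x b i j = 4 * \<Lambda> * Q g C x b i j + Q Ric C x b i j)"
proof -
  define \<alpha> where "\<alpha> r = (2 * M * r - 3 * e^2 + \<Lambda> * r^4) / r^4" for r
  define \<beta> where "\<beta> r = (e^2 - M * r + \<Lambda> * r^4) / r^4" for r
  define \<delta> where "\<delta> r = (2 * M * r - e^2 + \<Lambda> * r^4) / r^4" for r
  define \<mu> where "\<mu> r = (M * r - e^2) / r^4" for r
  have pos: "x $ 2 > 0" if "x \<in> D" for x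
    using that assms(4) by (simp add: rnds_domain_def)
  have D: "open D"
    unfolding assms(4) rnds_domain_sss by (rule open_sss_domain[OF rnds_f_deriv])
  have G: "diag_at (sss_diag (rnds_f M e \<Lambda>) x) (gm x)"
    and RB: "plane_form (sss_diag (rnds_f M e \<Lambda>) x) (block (\<alpha> (x $ 2)) (\<beta> (x $ 2)) (\<delta> (x $ 2))) x (riemann gm)"
    if "x \<in> D" for x
    using rnds_curvature that unfolding assms(3,4) \<alpha>_def \<beta>_def \<delta>_def by blast+
  have mu: "\<mu> (x $ 2) = (\<alpha> (x $ 2) + \<delta> (x $ 2) - 2 * \<beta> (x $ 2)) / 6" if "x \<in> D" for x
    using pos[OF that] by (simp add: \<mu>_def \<alpha>_def \<beta>_def \<delta>_def field_simps)
  note CB = conformal_block[OF mu G RB] and SB = ricci_block[OF mu G RB]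
  have smooth: "smooth_on D (\<lambda>x. \<mu> (x $ 2))" "smooth_on D (\<lambda>x. - \<beta> (x $ 2))"
  proof -
    have eq: "\<mu> (x $ 2) = 0 + M / (x $ 2) ^ 3 + (- (e^2)) / (x $ 2) ^ 4"
      "- \<beta> (x $ 2) = - \<Lambda> + M / (x $ 2) ^ 3 + (- (e^2)) / (x $ 2) ^ 4" if "x \<in> D" for x
      using pos[OF that] by (simp_all add: \<mu>_def \<beta>_def field_simps eval_nat_numeral)
    show "smooth_on D (\<lambda>x. \<mu> (x $ 2))" "smooth_on D (\<lambda>x. - \<beta> (x $ 2))"
      using D Ck_on_inverse_powers[OF D pos eq(1)] Ck_on_inverse_powers[OF D pos eq(2)]
      by (auto simp: smooth_on_def)
  qed
  have RC: "dot gm R C x b i j = - \<beta> (x $ 2) * Q g C x b i j" if "x \<in> D" "length b = 4" for x b i j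
    unfolding assms(5-8) by (rule dot_block_plane[where g = gm, OF G RB CB]) (use that in auto)
  have CS: "dot gm C Ric x b i j = \<mu> (x $ 2) * Q g Ric x b i j" if "x \<in> D" "length b = 2" for x b i j
    unfolding assms(5-8) using dot_block_diag[where g = gm, OF G CB SB] that by simp
  have CC: "dot gm C C x b i j = \<mu> (x $ 2) * Q g C x b i j" if "x \<in> D" "length b = 4" for x b i j
    unfolding assms(5-8) using dot_block_plane[where g = gm, OF G CB CB] that by simp
  have CR: "dot gm C R x b i j = \<mu> (x $ 2) * Q g R x b i j" if "x \<in> D" "length b = 4" for x b i j
    unfolding assms(5-8) using dot_block_plane[where g = gm, OF G CB RB] that by simp
  have RR: "dot gm R R x b i j - Q Ric R x b i j =
      (2 * e^4 - 6 * e^2 * M * r + 3 * M^2 * r^2 - 6 * \<Lambda> * e^2 * r^4 + 6 * M * \<Lambda> * r^5)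
        / (3 * r^4 * (M * r - e^2)) * Q g C x b i j"
    if x: "x \<in> D" and b: "length b = 4" and r: "r = x $ 2" and nz: "M * r - e^2 \<noteq> 0" for x b i j r
  proof -
    have r0: "r > 0" using pos[OF x] r by simp
    have "(\<alpha> r * \<delta> r - (\<beta> r)^2) / (3 * \<mu> r) =
      (2 * e^4 - 6 * e^2 * M * r + 3 * M^2 * r^2 - 6 * \<Lambda> * e^2 * r^4 + 6 * M * \<Lambda> * r^5)
        / (3 * r^4 * (M * r - e^2))"
      using r0 nz by (simp add: \<alpha>_def \<beta>_def \<delta>_def \<mu>_def field_simps eval_nat_numeral)
    moreover have "\<mu> r \<noteq> 0" using r0 nz by (simp add: \<mu>_def)
    ultimately show ?thesis
      unfolding assms(5-8) using dot_riemann_riemann_block[OF mu[OF x] G[OF x] RB[OF x] _ b] r by simp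
  qed
  have CRRC: "dot gm C R x b i j - dot gm R C x b i j = L1 * Q g R x b i j + L2 * Q Ric R x b i j"
    if x: "x \<in> D" and b: "length b = 4" and r: "r = x $ 2"
      and Y2: "Y2 = - M * r + \<Lambda> * r^4 + e^2" and Y6: "Y6 = M * r - e^2"
      and N: "N = 3 * M * r * (M * r - 2 * e^2) + 6 * \<Lambda> * r^4 * Y6 + 2 * e^4"
      and L1: "L1 = Y6 / r^4 * (1 - 3 * Y2^2 / N)" and L2: "L2 = - (3 * Y6 * Y2) / N" and nz: "N \<noteq> 0"
    for x b i j r Y2 Y6 N L1 L2
  proof -
    have r0: "r > 0" using pos[OF x] r by simp
    \<comment> \<open>The divisor of \<open>L2\<close> in the general block formula is \<open>N\<close> up to a power of \<open>r\<close>.\<close>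
    have det: "\<alpha> r * \<delta> r - (\<beta> r)^2 = N / r^8"
      using r0 by (simp add: \<alpha>_def \<beta>_def \<delta>_def N Y6 field_simps eval_nat_numeral)
    have \<beta>: "\<beta> r = Y2 / r^4" and \<mu>: "\<mu> r = Y6 / r^4" by (simp_all add: \<beta>_def \<mu>_def Y2 Y6)
    have L2': "- 3 * \<beta> r * \<mu> r / (\<alpha> r * \<delta> r - (\<beta> r)^2) = L2"
      by (simp only: det) (use r0 nz in \<open>simp add: \<beta> \<mu> L2 field_simps eval_nat_numeral\<close>)
    have L1': "\<mu> r + \<beta> r * L2 = L1"
      unfolding \<beta> \<mu> L2 L1 using r0 nz by (simp add: field_simps eval_nat_numeral)
    have "\<alpha> (x $ 2) * \<delta> (x $ 2) \<noteq> (\<beta> (x $ 2))^2" using det r0 nz r by auto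
    from dot_conformal_riemann_commutator_riemann[OF mu[OF x] G[OF x] RB[OF x] this b, of i j]
    show ?thesis
      unfolding assms(5-8) by (simp only: r[symmetric] L2' L1')
  qed
  have CRRC': "dot gm C R x b i j - dot gm R C x b i j = 4 * \<Lambda> * Q g C x b i j + Q Ric C x b i j"
    if x: "x \<in> D" and b: "length b = 4" for x b i j
  proof -
    have "2 * (\<alpha> (x $ 2) + \<delta> (x $ 2) + 4 * \<beta> (x $ 2)) / 3 = 4 * \<Lambda>"
      using pos[OF x] by (simp add: \<alpha>_def \<beta>_def \<delta>_def field_simps)
    then show ?thesis
      unfolding assms(5-8)
      using dot_conformal_riemann_commutator_conformal[OF mu[OF x] G[OF x] RB[OF x] b, of i j] by simp
  qed
  have ps: "pseudosymmetric_wrt D gm R 4 C" "pseudosymmetric_wrt D gm C 2 Ric"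
    "pseudosymmetric_wrt D gm C 4 C" "pseudosymmetric_wrt D gm C 4 R"
    unfolding pseudosymmetric_wrt_def assms(5)[symmetric]
    using smooth RC CS CC CR by blast+
  show ?thesis
    unfolding Let_def
    using ps RC CS CC CR RR[OF _ _ refl] CRRC[OF _ _ refl refl refl refl refl refl] CRRC'
    unfolding \<beta>_def \<mu>_def
    by (intro conjI ballI allI impI) assumption+
qed

end
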